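(* Let $(X,d)$ be a metric space and let $\mathcal{S}$ be a bornology on $X$. Then the following statements are equivalent: (i) $\tau_{\mathcal{S},d}^+ = \mathsf{G}_{\mathcal{S},d}^+$ on $CL(X)$; (ii) for each $S \in \mathcal{S}$ and $f, g \in \mathcal{Z}^+$ with $\inf\{g(x)-f(x) : x \in S\} > 0$, either $B_d(S,f)$ is strictly $(\mathcal{S}-d)$ included in $B_d(S,g)$ or $B_d(S,g) = X$.
   Context: $\mathcal{P}_0(X)$ is the family of all nonempty subsets of $X$ and $CL(X)$ the family of all nonempty closed subsets. A bornology on $X$ is a nonempty family $\mathcal{S} \subseteq \mathcal{P}_0(X)$ that is hereditary (closed under taking nonempty subsets), closed under finite unions, and covers $X$. $d(x,A)=\inf\{d(x,a):a\in A\}$; for $\epsilon>0$, $B_d(A,\epsilon)=\{x\in X: d(x,A)<\epsilon\}$. $\mathcal{Z}^+$ is the set of all functions $f:X\to\mathbb{R}$ with $f(x)>0$ for all $x$; for nonempty $S\subseteq X$ and $f\in\mathcal{Z}^+$, $B_d(S,f)=\bigcup_{x\in S}B_d(x,f(x))$, where $B_d(x,r)$ is the open ball. The topology $\tau_{\mathcal{S},d}^+$ on $\mathcal{P}_0(X)$ is the one induced by the quasi-uniformity with base the sets $[S,\epsilon]^+=\{(A,C): d(x,A)-d(x,C)<\epsilon\ \forall x\in S\}$ ($S\in\mathcal{S}$, $\epsilon>0$); so a net $(A_\lambda)$ converges to $A$ in it iff for every $S\in\mathcal{S}$ and $\epsilon>0$, eventually $d(x,A)-d(x,A_\lambda)<\epsilon$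 for all $x\in S$. The gap functional is $D_d(S,A)=\inf\{d(x,a):x\in S,a\in A\}$. The upper gap topology $\mathsf{G}_{\mathcal{S},d}^+$ is the weakest topology on $\mathcal{P}_0(X)$ for which each functional $C\mapsto D_d(S,C)$, $S\in\mathcal{S}$, is lower semicontinuous; a base consists of $\mathcal{P}_0(X)$ together with the sets $\{C\in\mathcal{P}_0(X): D_d(C,S_i)>\epsilon_i,\ i=1,\dots,n\}$ with $n\in\mathbb{N}$, $S_i\in\mathcal{S}$, $\epsilon_i>0$. Both topologies are considered as restricted to $CL(X)$. A subset $A$ of $X$ is strictly $(\mathcal{S}-d)$ included in a nonempty subset $C$ of $X$ if there are finitely many $S_1,\dots,S_n\in\mathcal{S}$ and numbers $0<\alpha_i<\epsilon_i$ ($1\le i\le n$) with $A\subseteq\bigcup_{i=1}^n B_d(S_i,\alpha_i)\subseteq\bigcup_{i=1}^n B_d(S_i,\epsilon_i)\subseteq C$. *)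

theory Defs
  imports "HOL-Analysis.Analysis"
begin

definition nonempty_sets :: "'a set set" where
  "nonempty_sets = {A. A \<noteq> {}}"

definition nonempty_closed_sets :: "'a::topological_space set set" where
  "nonempty_closed_sets = {A. A \<noteq> {} \<and> closed A}"

definition bornology :: "'a set set \<Rightarrow> bool" where
  "bornology \<S> \<longleftrightarrow>
     \<S> \<noteq> {} \<and> \<S> \<subseteq> nonempty_sets \<and>
     (\<forall>S\<in>\<S>. \<forall>T. T \<noteq> {} \<and> T \<subseteq> S \<longrightarrow> T \<in> \<S>) \<and>
     (\<forall>S\<in>\<S>. \<forall>T\<in>\<S>. S \<union> T \<in> \<S>) \<and>
     \<Union>\<S> = UNIV"

definition enlargement :: "'a::metric_space set \<Rightarrow> real \<Rightarrow> 'a set" where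
  "enlargement A \<epsilon> = {x. infdist x A < \<epsilon>}"

definition positive_functions :: "('a \<Rightarrow> real) set" where
  "positive_functions = {f. \<forall>x. f x > 0}"

definition fun_enlargement :: "'a::metric_space set \<Rightarrow> ('a \<Rightarrow> real) \<Rightarrow> 'a set" where
  "fun_enlargement S f = (\<Union>x\<in>S. ball x (f x))"

definition strictly_included :: "'a::metric_space set set \<Rightarrow> 'a set \<Rightarrow> 'a set \<Rightarrow> bool" where
  "strictly_included \<S> A C \<longleftrightarrow>
     (\<exists>n\<ge>1. \<exists>(S :: nat \<Rightarrow> 'a set) (\<alpha> :: nat \<Rightarrow> real) (\<epsilon> :: nat \<Rightarrow> real).
        (\<forall>i\<in>{1..n}. S i \<in> \<S> \<and> 0 < \<alpha> i \<and> \<alpha> i < \<epsilon> i) \<and>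
        A \<subseteq> (\<Union>i\<in>{1..n}. enlargement (S i) (\<alpha> i)) \<and>
        (\<Union>i\<in>{1..n}. enlargement (S i) (\<alpha> i)) \<subseteq> (\<Union>i\<in>{1..n}. enlargement (S i) (\<epsilon> i)) \<and>
        (\<Union>i\<in>{1..n}. enlargement (S i) (\<epsilon> i)) \<subseteq> C)"


definition quasi_uniformity_base :: "'b set \<Rightarrow> ('b \<times> 'b) set set \<Rightarrow> bool" where
  "quasi_uniformity_base Y \<B> \<longleftrightarrow>
     \<B> \<noteq> {} \<and>
     (\<forall>U\<in>\<B>. Id_on Y \<subseteq> U \<and> U \<subseteq> Y \<times> Y) \<and>
     (\<forall>U\<in>\<B>. \<forall>V\<in>\<B>. \<exists>W\<in>\<B>. W \<subseteq> U \<inter> V) \<and>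
     (\<forall>U\<in>\<B>. \<exists>V\<in>\<B>. V O V \<subseteq> U)"

(* The neighbourhoods of A are generated by the sections {C. (A, C) \<in> U}: the first
   coordinate is the centre. The opposite choice gives the conjugate topology. *)
definition quasi_uniform_topology :: "'b set \<Rightarrow> ('b \<times> 'b) set set \<Rightarrow> 'b topology" where
  "quasi_uniform_topology Y \<B> =
     topology (\<lambda>G. G \<subseteq> Y \<and> (\<forall>A\<in>G. \<exists>U\<in>\<B>. U `` {A} \<subseteq> G))"

lemma openin_quasi_uniform_topology:
  assumes "quasi_uniformity_base Y \<B>"
  shows "openin (quasi_uniform_topology Y \<B>) G \<longleftrightarrow>
           G \<subseteq> Y \<and> (\<forall>A\<in>G. \<exists>U\<in>\<B>. U `` {A} \<subseteq> G)"
proof -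
  have "istopology (\<lambda>G. G \<subseteq> Y \<and> (\<forall>A\<in>G. \<exists>U\<in>\<B>. U `` {A} \<subseteq> G))"
    unfolding istopology_def
  proof (intro conjI allI impI ballI)
    fix G H A
    assume G: "G \<subseteq> Y \<and> (\<forall>A\<in>G. \<exists>U\<in>\<B>. U `` {A} \<subseteq> G)"
      and H: "H \<subseteq> Y \<and> (\<forall>A\<in>H. \<exists>U\<in>\<B>. U `` {A} \<subseteq> H)" and A: "A \<in> G \<inter> H"
    obtain U where U: "U \<in> \<B>" "U `` {A} \<subseteq> G" using G A by blast
    obtain V where V: "V \<in> \<B>" "V `` {A} \<subseteq> H" using H A by blast
    obtain W where "W \<in> \<B>" "W \<subseteq> U \<inter> V"
      using assms U(1) V(1) unfolding quasi_uniformity_base_def by meson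
    then show "\<exists>U\<in>\<B>. U `` {A} \<subseteq> G \<inter> H" using U(2) V(2) by blast
  next
    fix \<K> A
    assume K: "\<forall>K\<in>\<K>. K \<subseteq> Y \<and> (\<forall>A\<in>K. \<exists>U\<in>\<B>. U `` {A} \<subseteq> K)" and A: "A \<in> \<Union>\<K>"
    obtain K where "K \<in> \<K>" "A \<in> K" using A by blast
    then show "\<exists>U\<in>\<B>. U `` {A} \<subseteq> \<Union>\<K>" using K by (meson Union_upper order_trans)
  qed auto
  then show ?thesis
    unfolding quasi_uniform_topology_def by simp
qed

definition upper_entourage :: "'a::metric_space set \<Rightarrow> real \<Rightarrow> ('a set \<times> 'a set) set" where
  "upper_entourage S \<epsilon> =
     {(A, C). A \<in> nonempty_sets \<and> C \<in> nonempty_sets \<and> (\<forall>x\<in>S. infdist x A - infdist x C < \<epsilon>)}"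

definition tau_upper :: "'a::metric_space set set \<Rightarrow> 'a set topology" where
  "tau_upper \<S> =
     quasi_uniform_topology nonempty_sets {upper_entourage S \<epsilon> | S \<epsilon>. S \<in> \<S> \<and> \<epsilon> > 0}"

lemma quasi_uniformity_base_upper_entourage:
  fixes \<S> :: "'a::metric_space set set"
  assumes "bornology \<S>"
  shows "quasi_uniformity_base nonempty_sets {upper_entourage S \<epsilon> | S \<epsilon>. S \<in> \<S> \<and> \<epsilon> > 0}"
    (is "quasi_uniformity_base _ ?B")
  unfolding quasi_uniformity_base_def
proof (intro conjI ballI)
  have "\<S> \<noteq> {}" using assms by (simp add: bornology_def)
  then obtain S where "S \<in> \<S>" by blast
  then have "upper_entourage S 1 \<in> ?B" by (auto intro!: exI[of _ S] exI[of _ "1::real"])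
  then show "?B \<noteq> {}" by blast
next
  fix U assume "U \<in> ?B"
  then show "Id_on nonempty_sets \<subseteq> U" "U \<subseteq> nonempty_sets \<times> nonempty_sets"
    by (auto simp: upper_entourage_def)
next
  fix U V assume "U \<in> ?B" "V \<in> ?B"
  then obtain S T and \<delta> \<epsilon> :: real where *: "U = upper_entourage S \<delta>" "V = upper_entourage T \<epsilon>"
    "S \<in> \<S>" "T \<in> \<S>" "\<delta> > 0" "\<epsilon> > 0" by blast
  have "S \<union> T \<in> \<S>" using * assms by (simp add: bornology_def)
  moreover have "upper_entourage (S \<union> T) (min \<delta> \<epsilon>) \<subseteq> U \<inter> V"
    using * by (auto simp: upper_entourage_def)
  moreover have "min \<delta> \<epsilon> > 0" using * by simp
  ultimately show "\<exists>W\<in>?B. W \<subseteq> U \<inter> V" by blast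
next
  fix U assume "U \<in> ?B"
  then obtain S and \<epsilon> :: real where *: "U = upper_entourage S \<epsilon>" "S \<in> \<S>" "\<epsilon> > 0" by blast
  have "upper_entourage S (\<epsilon>/2) O upper_entourage S (\<epsilon>/2) \<subseteq> U"
  proof (rule subrelI)
    fix A C
    assume "(A, C) \<in> upper_entourage S (\<epsilon>/2) O upper_entourage S (\<epsilon>/2)"
    then obtain B where AB: "(A, B) \<in> upper_entourage S (\<epsilon>/2)"
      and BC: "(B, C) \<in> upper_entourage S (\<epsilon>/2)" by blast
    have "infdist x A - infdist x C < \<epsilon>" if "x \<in> S" for x
    proof -
      have "infdist x A - infdist x B < \<epsilon>/2" "infdist x B - infdist x C < \<epsilon>/2"
        using AB BC that by (simp_all only: upper_entourage_def mem_Collect_eq prod.case)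
      then show ?thesis by linarith
    qed
    then show "(A, C) \<in> U"
      using AB BC by (simp add: *(1) upper_entourage_def)
  qed
  moreover have "\<epsilon>/2 > 0" using * by simp
  ultimately show "\<exists>V\<in>?B. V O V \<subseteq> U" using *(2) by blast
qed


definition lower_semicontinuous_map :: "'b topology \<Rightarrow> ('b \<Rightarrow> real) \<Rightarrow> bool" where
  "lower_semicontinuous_map T f \<longleftrightarrow> (\<forall>\<alpha>. openin T {x \<in> topspace T. f x > \<alpha>})"

definition upper_gap :: "'a::metric_space set set \<Rightarrow> 'a set topology" where
  "upper_gap \<S> =
     topology_generated_by {{C \<in> nonempty_sets. setdist S C > \<alpha>} | S \<alpha>. S \<in> \<S>}"

(* upper_gap is the weakest topology on the nonempty sets making the gap functionals
   lower semicontinuous. *)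

lemma topspace_upper_gap:
  assumes "bornology \<S>"
  shows "topspace (upper_gap \<S>) = nonempty_sets"
proof -
  have "\<S> \<noteq> {}" using assms by (simp add: bornology_def)
  then obtain S where "S \<in> \<S>" by blast
  moreover have "{C \<in> nonempty_sets. setdist S C > -1} = nonempty_sets"
    using setdist_pos_le[of S] by (auto intro: less_le_trans[of "-1" 0])
  ultimately have "nonempty_sets \<in> {{C \<in> nonempty_sets. setdist S C > \<alpha>} | S \<alpha>. S \<in> \<S>}"
    by (intro CollectI exI[of _ S] exI[of _ "-1::real"]) simp
  then show ?thesis unfolding upper_gap_def topology_generated_by_topspace by blast
qed

lemma lower_semicontinuous_map_upper_gap:
  assumes "bornology \<S>" "S \<in> \<S>"
  shows "lower_semicontinuous_map (upper_gap \<S>) (setdist S)"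
  unfolding lower_semicontinuous_map_def topspace_upper_gap[OF assms(1)]
  using assms(2) by (auto simp: upper_gap_def intro!: topology_generated_by_Basis)

lemma upper_gap_weakest:
  assumes "topspace T = nonempty_sets"
    and "\<And>S. S \<in> \<S> \<Longrightarrow> lower_semicontinuous_map T (setdist S)"
    and "openin (upper_gap \<S>) G"
  shows "openin T G"
proof -
  have "generate_topology_on {{C \<in> nonempty_sets. setdist S C > \<alpha>} | S \<alpha>. S \<in> \<S>} G"
    using assms(3) unfolding upper_gap_def openin_topology_generated_by_iff .
  then show ?thesis
  proof (induction rule: generate_topology_on.induct)
    case (Basis s)
    then show ?case using assms(1,2) unfolding lower_semicontinuous_map_def by force
  qed (auto intro: openin_Union)
qed

end

theory Submission
  imports Defs
begin

text \<open>
  The gap topology is always the coarser one. The passage between the two remaining conditions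
  rests on the correspondence between a set \<open>A\<close> and the open set \<open>B(S, g)\<close>: the complement of
  \<open>B(S, g)\<close> satisfies \<open>d(x, A) \<ge> g x\<close> on \<open>S\<close>, and conversely \<open>B(S, g)\<close> misses \<open>A\<close> when
  \<open>g x = d(x, A)\<close>. Strict inclusion of \<open>B(S, f)\<close> in \<open>B(S, g)\<close> then amounts to a basic gap
  neighbourhood of \<open>A\<close> whose members all miss \<open>B(S, f)\<close>. To read off strict inclusion from such a
  neighbourhood it suffices to test it on the closed sets \<open>{y}\<close> with \<open>y \<in> B(S, f)\<close>.
\<close>

section \<open>Gaps, point distances and enlargements\<close>

text \<open>Strict pointwise bounds may become equalities in the infimum; the uniform \<beta> above
  \<alpha> keeps the gap strictly larger.\<close>

lemma less_setdist_infdistI: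
  assumes "S \<noteq> {}" "C \<noteq> {}" "\<And>x. x \<in> S \<Longrightarrow> \<beta> \<le> infdist x C" "\<alpha> < \<beta>"
  shows "\<alpha> < setdist S C"
proof -
  have "\<beta> \<le> dist x c" if "x \<in> S" "c \<in> C" for x c
    using assms(3)[OF that(1)] infdist_le[OF that(2), of x] by linarith
  then have "\<beta> \<le> setdist S C"
    using assms(1,2) by (simp add: le_setdist_iff)
  then show ?thesis using assms(4) by linarith
qed

lemma setdist_le_infdist:
  assumes "x \<in> S"
  shows "setdist S C \<le> infdist x C"
  using setdist_subset_left[of "{x}" S C] assms by (simp add: infdist_eq_setdist)

lemma fun_enlargement_disjoint_iff:
  "fun_enlargement S f \<inter> C = {} \<longleftrightarrow> (\<forall>x\<in>S. \<forall>c\<in>C. f x \<le> dist x c)"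
  by (force simp: fun_enlargement_def not_le[symmetric])

text \<open>No point of \<open>A\<close> is nearer to \<open>S\<close> than the gap. The gap can
  thus serve as outer radius for strict inclusion in the complement of \<open>A\<close>.\<close>

lemma enlargement_disjoint_setdist: "enlargement S (setdist S A) \<inter> A = {}"
  using setdist_le_infdist[of _ A S]
  by (fastforce simp: enlargement_def setdist_sym[of S])

section \<open>Open sets of \<open>tau_upper\<close>\<close>

lemma openin_tau_upper:
  assumes "bornology \<S>"
  shows "openin (tau_upper \<S>) G \<longleftrightarrow>
    G \<subseteq> nonempty_sets \<and> (\<forall>A\<in>G. \<exists>S\<in>\<S>. \<exists>\<epsilon>>0. upper_entourage S \<epsilon> `` {A} \<subseteq> G)"
  unfolding tau_upper_def
    openin_quasi_uniform_topology[OF quasi_uniformity_base_upper_entourage[OF assms]]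
  by blast

text \<open>The slack \<open>\<delta> < \<epsilon>\<close> makes the entourage section open.\<close>

lemma openin_tau_upper_section:
  assumes "bornology \<S>" "S \<in> \<S>"
  shows "openin (tau_upper \<S>)
    {C \<in> nonempty_sets. \<exists>\<delta><\<epsilon>. \<forall>x\<in>S. infdist x A - infdist x C \<le> \<delta>}" (is "openin _ ?G")
  unfolding openin_tau_upper[OF assms(1)]
proof (intro conjI ballI)
  fix C assume "C \<in> ?G"
  then obtain \<delta> where \<delta>: "\<delta> < \<epsilon>" "\<And>x. x \<in> S \<Longrightarrow> infdist x A - infdist x C \<le> \<delta>"
    by blast
  have "upper_entourage S ((\<epsilon> - \<delta>) / 2) `` {C} \<subseteq> ?G"
  proof
    fix E assume "E \<in> upper_entourage S ((\<epsilon> - \<delta>) / 2) `` {C}"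
    then have E: "E \<in> nonempty_sets"
        "\<And>x. x \<in> S \<Longrightarrow> infdist x C - infdist x E < (\<epsilon> - \<delta>) / 2"
      by (auto simp: upper_entourage_def)
    have "infdist x A - infdist x E \<le> (\<epsilon> + \<delta>) / 2" if "x \<in> S" for x
      using \<delta>(2)[OF that] E(2)[OF that] by (simp add: field_simps)
    moreover have "(\<epsilon> + \<delta>) / 2 < \<epsilon>" using \<delta>(1) by simp
    ultimately show "E \<in> ?G" using E(1) by blast
  qed
  moreover have "(\<epsilon> - \<delta>) / 2 > 0" using \<delta>(1) by simp
  ultimately show "\<exists>S\<in>\<S>. \<exists>\<epsilon>>0. upper_entourage S \<epsilon> `` {C} \<subseteq> ?G"
    using assms(2) by blast
qed blast

lemma topspace_tau_upper:
  assumes "bornology \<S>"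
  shows "topspace (tau_upper \<S>) = nonempty_sets"
proof -
  obtain S where S: "S \<in> \<S>" using assms by (auto simp: bornology_def)
  have "openin (tau_upper \<S>) nonempty_sets"
    unfolding openin_tau_upper[OF assms]
    using S by (auto simp: upper_entourage_def intro!: bexI[of _ S] exI[of _ "1::real"])
  moreover have "topspace (tau_upper \<S>) \<subseteq> nonempty_sets"
    using openin_tau_upper[OF assms] openin_topspace by metis
  ultimately show ?thesis by (intro subset_antisym openin_subset)
qed

text \<open>Moving from \<open>A\<close> to \<open>C\<close> inside an entourage over
  \<open>S\<close> lowers each distance from a point of \<open>S\<close> by less than \<epsilon>,
  hence the gap by at most \<epsilon>. So the gap functionals are lower semicontinuous for
  \<open>tau_upper\<close>, and the gap topology is the weakest with this property.\<close>

lemma upper_gap_coarser_tau_upper: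
  assumes \<S>: "bornology \<S>" and G: "openin (upper_gap \<S>) G"
  shows "openin (tau_upper \<S>) G"
proof (rule upper_gap_weakest[OF topspace_tau_upper[OF \<S>] _ G])
  fix S assume S: "S \<in> \<S>"
  then have "S \<noteq> {}" using \<S> by (auto simp: bornology_def nonempty_sets_def)
  have "openin (tau_upper \<S>) {A \<in> nonempty_sets. \<alpha> < setdist S A}" (is "openin _ ?G") for \<alpha>
    unfolding openin_tau_upper[OF \<S>]
  proof (intro conjI ballI)
    fix A assume A: "A \<in> ?G"
    \<comment> \<open>Half of the excess over \<alpha> may be lost; the other half keeps the
      inequality strict in the infimum.\<close>
    define \<epsilon> where "\<epsilon> = (setdist S A - \<alpha>) / 2"
    have \<epsilon>: "\<epsilon> > 0" "\<alpha> < setdist S A - \<epsilon>" using A by (simp_all add: \<epsilon>_def field_simps)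
    have "C \<in> ?G" if "(A, C) \<in> upper_entourage S \<epsilon>" for C
    proof -
      from that have C: "C \<in> nonempty_sets" "\<And>x. x \<in> S \<Longrightarrow> infdist x A - infdist x C < \<epsilon>"
        by (auto simp: upper_entourage_def)
      have "setdist S A - \<epsilon> \<le> infdist x C" if "x \<in> S" for x
        using C(2)[OF that] setdist_le_infdist[OF that, of A] by linarith
      then show ?thesis
        using C(1) less_setdist_infdistI[OF \<open>S \<noteq> {}\<close> _ _ \<epsilon>(2)] by (auto simp: nonempty_sets_def)
    qed
    then have "upper_entourage S \<epsilon> `` {A} \<subseteq> ?G" by blast
    then show "\<exists>S\<in>\<S>. \<exists>\<epsilon>>0. upper_entourage S \<epsilon> `` {A} \<subseteq> ?G" using S \<epsilon>(1) by blast
  qed blast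
  then show "lower_semicontinuous_map (tau_upper \<S>) (setdist S)"
    by (simp add: lower_semicontinuous_map_def topspace_tau_upper[OF \<S>])
qed

section \<open>Basic neighbourhoods of the gap topology\<close>

text \<open>Each pair holds a set and its threshold, so intersecting neighbourhoods means uniting
  index sets, and the empty index set gives the whole space.\<close>

definition gap_nbhd :: "('a::metric_space set \<times> real) set \<Rightarrow> 'a set set" where
  "gap_nbhd F = {C \<in> nonempty_sets. \<forall>(S, \<alpha>)\<in>F. \<alpha> < setdist S C}"

lemma openin_gap_nbhd:
  assumes \<S>: "bornology \<S>" and F: "finite F" "fst ` F \<subseteq> \<S>"
  shows "openin (upper_gap \<S>) (gap_nbhd F)"
proof -
  have "openin (upper_gap \<S>) {C \<in> nonempty_sets. snd p < setdist (fst p) C}" if "p \<in> F" for p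
    unfolding upper_gap_def using F(2) that by (intro topology_generated_by_Basis) blast
  moreover have "openin (upper_gap \<S>) nonempty_sets"
    using topspace_upper_gap[OF \<S>] openin_topspace by metis
  \<comment> \<open>The inserted whole space keeps the intersected family nonempty even for empty
    \<open>F\<close>, where the intersection would otherwise be \<open>UNIV\<close>.\<close>
  moreover have "gap_nbhd F =
      \<Inter>(insert nonempty_sets ((\<lambda>p. {C \<in> nonempty_sets. snd p < setdist (fst p) C}) ` F))"
    by (auto simp: gap_nbhd_def split_beta)
  ultimately show ?thesis
    using F(1) by (simp only:) (rule openin_Inter, auto)
qed

text \<open>Nonnegative thresholds ensure that the midpoint between a threshold and a larger gap is
  positive, as a radius in a strict inclusion must be.\<close>

lemma openin_upper_gapD:
  assumes \<S>: "bornology \<S>" and "openin (upper_gap \<S>) G" "A \<in> G"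
  obtains F where "finite F" "fst ` F \<subseteq> \<S>" "\<And>p. p \<in> F \<Longrightarrow> 0 \<le> snd p"
    "A \<in> gap_nbhd F" "gap_nbhd F \<subseteq> G"
proof -
  have "generate_topology_on {{C \<in> nonempty_sets. setdist S C > \<alpha>} | S \<alpha>. S \<in> \<S>} G"
    using assms(2) unfolding upper_gap_def openin_topology_generated_by_iff .
  then have "\<exists>F. finite F \<and> fst ` F \<subseteq> \<S> \<and> (\<forall>p\<in>F. 0 \<le> snd p) \<and> A \<in> gap_nbhd F \<and> gap_nbhd F \<subseteq> G"
    using \<open>A \<in> G\<close>
  proof (induction rule: generate_topology_on.induct)
    case (Int G H)
    then obtain F F' where "finite F \<and> fst ` F \<subseteq> \<S> \<and> (\<forall>p\<in>F. 0 \<le> snd p) \<and> A \<in> gap_nbhd F \<and> gap_nbhd F \<subseteq> G"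
      "finite F' \<and> fst ` F' \<subseteq> \<S> \<and> (\<forall>p\<in>F'. 0 \<le> snd p) \<and> A \<in> gap_nbhd F' \<and> gap_nbhd F' \<subseteq> H"
      by auto
    moreover have "gap_nbhd (F \<union> F') = gap_nbhd F \<inter> gap_nbhd F'"
      by (auto simp: gap_nbhd_def)
    ultimately show ?case by (intro exI[of _ "F \<union> F'"]) auto
  next
    case (UN K)
    then obtain k where "k \<in> K" "A \<in> k" by blast
    with UN.IH show ?case by (meson Union_upper order_trans)
  next
    case (Basis G)
    then obtain S \<alpha> where G: "G = {C \<in> nonempty_sets. \<alpha> < setdist S C}" "S \<in> \<S>" by blast
    show ?case
    proof (cases "\<alpha> < 0")
      \<comment> \<open>Gaps are never negative, so this subbasic set is the whole space and needs
        no pair.\<close>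
      case True
      then have "G = gap_nbhd {}"
        unfolding G gap_nbhd_def by (auto intro: less_le_trans[OF _ setdist_pos_le])
      with Basis.prems show ?thesis by (intro exI[of _ "{}"]) simp
    next
      case False
      have "G = gap_nbhd {(S, \<alpha>)}" by (simp add: G gap_nbhd_def)
      with Basis.prems False \<open>S \<in> \<S>\<close> show ?thesis by (intro exI[of _ "{(S, \<alpha>)}"]) simp
    qed
  qed simp
  then show thesis using that by blast
qed

section \<open>Witnesses of strict inclusion\<close>

text \<open>Enumerating any finite index set gives the numbering from 1; the middle inclusion is
  monotonicity of enlargements in the radius.\<close>

lemma strictly_includedI:
  fixes F :: "'b set" and S :: "'b \<Rightarrow> 'a::metric_space set"
  assumes F: "finite F" "F \<noteq> {}" "\<And>p. p \<in> F \<Longrightarrow> S p \<in> \<S> \<and> 0 < \<alpha> p \<and> \<alpha> p < \<epsilon> p"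
    and A: "A \<subseteq> (\<Union>p\<in>F. enlargement (S p) (\<alpha> p))"
    and C: "(\<Union>p\<in>F. enlargement (S p) (\<epsilon> p)) \<subseteq> C"
  shows "strictly_included \<S> A C"
proof -
  obtain h where h: "bij_betw h {1..card F} F"
    using ex_bij_betw_nat_finite_1[OF F(1)] by blast
  then have F_eq: "F = h ` {1..card F}" by (simp add: bij_betw_def)
  have h_in: "h i \<in> F" if "i \<in> {1..card F}" for i using that F_eq by blast
  have reindex: "(\<Union>p\<in>F. E p) = (\<Union>i\<in>{1..card F}. E (h i))" for E :: "'b \<Rightarrow> 'a set"
    by (subst F_eq) blast
  have mono: "enlargement (S p) (\<alpha> p) \<subseteq> enlargement (S p) (\<epsilon> p)" if "p \<in> F" for p
    using F(3)[OF that] by (auto simp: enlargement_def)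
  have "card F \<ge> 1" using F(1,2) by (simp add: Suc_le_eq card_gt_0_iff)
  then show ?thesis
    unfolding strictly_included_def
  proof (intro exI conjI)
    show "\<forall>i\<in>{1..card F}. (S \<circ> h) i \<in> \<S> \<and> 0 < (\<alpha> \<circ> h) i \<and> (\<alpha> \<circ> h) i < (\<epsilon> \<circ> h) i"
      using F(3) h_in by simp
    show "A \<subseteq> (\<Union>i\<in>{1..card F}. enlargement ((S \<circ> h) i) ((\<alpha> \<circ> h) i))"
      using A unfolding reindex by simp
    show "(\<Union>i\<in>{1..card F}. enlargement ((S \<circ> h) i) ((\<alpha> \<circ> h) i))
        \<subseteq> (\<Union>i\<in>{1..card F}. enlargement ((S \<circ> h) i) ((\<epsilon> \<circ> h) i))"
      using mono h_in by (intro UN_mono) (simp_all del: atLeastAtMost_iff)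
    show "(\<Union>i\<in>{1..card F}. enlargement ((S \<circ> h) i) ((\<epsilon> \<circ> h) i)) \<subseteq> C"
      using C unfolding reindex by simp
  qed
qed

lemma strictly_includedE:
  assumes "strictly_included \<S> A C"
  obtains n :: nat and S \<alpha> \<epsilon> where
    "\<And>i. i \<in> {1..n} \<Longrightarrow> S i \<in> \<S> \<and> 0 < \<alpha> i \<and> \<alpha> i < \<epsilon> i"
    "A \<subseteq> (\<Union>i\<in>{1..n}. enlargement (S i) (\<alpha> i))"
    "(\<Union>i\<in>{1..n}. enlargement (S i) (\<epsilon> i)) \<subseteq> C"
  using assms unfolding strictly_included_def
  by (elim exE conjE, intro that) (rule bspec, assumption+)

section \<open>From equal topologies to strict inclusion\<close>

lemma strictly_included_if_gap_eq_tau: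
  fixes \<S> :: "'a::metric_space set set"
  assumes \<S>: "bornology \<S>"
    and eq: "subtopology (tau_upper \<S>) nonempty_closed_sets = subtopology (upper_gap \<S>) nonempty_closed_sets"
    and S: "S \<in> \<S>" and f: "f \<in> positive_functions"
    and inf: "(INF x\<in>S. ereal (g x - f x)) > 0"
    and g_UNIV: "fun_enlargement S g \<noteq> UNIV"
  shows "strictly_included \<S> (fun_enlargement S f) (fun_enlargement S g)"
proof -
  \<comment> \<open>A real number strictly below the extended-real infimum serves as a uniform
    margin between \<open>f\<close> and \<open>g\<close> on \<open>S\<close>.\<close>
  obtain \<epsilon> where \<epsilon>: "0 < \<epsilon>" "ereal \<epsilon> < (INF x\<in>S. ereal (g x - f x))"
    using ereal_dense2[OF inf] by auto
  have fg: "f x + \<epsilon> \<le> g x" if "x \<in> S" for x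
    using less_INF_D[OF \<epsilon>(2) that] by simp
  define A where "A = - fun_enlargement S g"
  have "A \<noteq> {}" using g_UNIV by (auto simp: A_def)
  have "open (fun_enlargement S g)" by (auto simp: fun_enlargement_def)
  with \<open>A \<noteq> {}\<close> have A: "A \<in> nonempty_closed_sets"
    by (simp add: A_def nonempty_closed_sets_def closed_def)
  have gA: "g x \<le> infdist x A" if "x \<in> S" for x
    using fun_enlargement_disjoint_iff[of S g A] that \<open>A \<noteq> {}\<close>
    by (auto simp: A_def infdist_notempty intro!: cINF_greatest)
  define W where "W = {C \<in> nonempty_sets. \<exists>\<delta><\<epsilon>. \<forall>x\<in>S. infdist x A - infdist x C \<le> \<delta>}"
  have "A \<in> W"
    using \<open>A \<noteq> {}\<close> \<epsilon>(1) by (auto simp: W_def nonempty_sets_def intro!: exI[of _ 0])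
  obtain H where H: "openin (upper_gap \<S>) H" "W \<inter> nonempty_closed_sets = H \<inter> nonempty_closed_sets"
    using eq openin_tau_upper_section[OF \<S> S, of \<epsilon> A] unfolding W_def[symmetric]
    by (metis openin_subtopology)
  have "A \<in> H" using \<open>A \<in> W\<close> A H(2) by blast
  then obtain F where F: "finite F" "fst ` F \<subseteq> \<S>" "\<And>p. p \<in> F \<Longrightarrow> 0 \<le> snd p"
      "A \<in> gap_nbhd F" "gap_nbhd F \<subseteq> H"
    using openin_upper_gapD[OF \<S> H(1)] by blast
  have gap: "snd p < setdist (fst p) A" if "p \<in> F" for p
    using F(4) that by (auto simp: gap_nbhd_def)
  \<comment> \<open>The midpoint lies above the threshold, so a point \<open>y\<close> outside all
    these enlargements has \<open>{y}\<close> in the gap neighbourhood, and below the gap with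
    \<open>A\<close>, which becomes the outer radius.\<close>
  define \<beta> where "\<beta> = (\<lambda>p. (snd p + setdist (fst p) A) / 2)"
  have cover: "fun_enlargement S f \<subseteq> (\<Union>p\<in>F. enlargement (fst p) (\<beta> p))"
  proof
    fix y assume "y \<in> fun_enlargement S f"
    then obtain x where x: "x \<in> S" "dist x y < f x" by (auto simp: fun_enlargement_def)
    show "y \<in> (\<Union>p\<in>F. enlargement (fst p) (\<beta> p))"
    proof (rule ccontr)
      assume y: "y \<notin> (\<Union>p\<in>F. enlargement (fst p) (\<beta> p))"
      have "snd p < setdist (fst p) {y}" if "p \<in> F" for p
      proof -
        have "snd p < \<beta> p" using gap[OF that] by (simp add: \<beta>_def)
        also have "\<beta> p \<le> setdist (fst p) {y}"
          using y that by (auto simp: enlargement_def infdist_eq_setdist setdist_sym not_less)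
        finally show ?thesis .
      qed
      then have "{y} \<in> gap_nbhd F" by (auto simp: gap_nbhd_def nonempty_sets_def)
      \<comment> \<open>\<open>H\<close> and \<open>W\<close> have the same closed members, and
        singletons are closed.\<close>
      then have "{y} \<in> W" using F(5) H(2) by (auto simp: nonempty_closed_sets_def)
      then have "infdist x A - infdist x {y} < \<epsilon>" using x(1) by (force simp: W_def)
      \<comment> \<open>Here d(x, A) \<ge> g x \<ge> f x + \<epsilon> > d(x, y) +
        \<epsilon>.\<close>
      then show False using gA[OF x(1)] fg[OF x(1)] x(2) by simp
    qed
  qed
  show ?thesis
  proof (rule strictly_includedI[OF F(1) _ _ cover])
    \<comment> \<open>Strict inclusion asks for at least one set; \<open>F\<close> is nonempty
      because it indexes a cover of the nonempty \<open>fun_enlargement S f\<close>.\<close>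
    have "S \<noteq> {}" using \<S> S by (auto simp: bornology_def nonempty_sets_def)
    then obtain x where "x \<in> S" by blast
    then have "x \<in> fun_enlargement S f"
      using f by (force simp: fun_enlargement_def positive_functions_def)
    then show "F \<noteq> {}" using cover by auto
    show "fst p \<in> \<S> \<and> 0 < \<beta> p \<and> \<beta> p < setdist (fst p) A" if "p \<in> F" for p
      using F(2) F(3)[OF that] gap[OF that] that by (auto simp: \<beta>_def)
    show "(\<Union>p\<in>F. enlargement (fst p) (setdist (fst p) A)) \<subseteq> fun_enlargement S g"
      using enlargement_disjoint_setdist[of _ A] by (auto simp: A_def)
  qed
qed

section \<open>From strict inclusion to equal topologies\<close>

text \<open>The inner radii of a strict inclusion act as gap thresholds: \<open>A\<close> misses the
  outer enlargements, so its gaps exceed them, and any set with such gaps misses the inner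
  enlargements.\<close>

lemma gap_nbhd_within_entourage:
  fixes \<S> :: "'a::metric_space set set"
  assumes \<S>: "bornology \<S>"
    and incl: "\<forall>S\<in>\<S>. \<forall>f\<in>positive_functions. \<forall>g\<in>positive_functions.
        (INF x\<in>S. ereal (g x - f x)) > 0 \<longrightarrow>
          strictly_included \<S> (fun_enlargement S f) (fun_enlargement S g) \<or>
          fun_enlargement S g = UNIV"
    and S: "S \<in> \<S>" and "\<epsilon> > 0" and A: "A \<in> nonempty_sets"
  obtains F where "finite F" "fst ` F \<subseteq> \<S>" "A \<in> gap_nbhd F"
    "gap_nbhd F \<subseteq> upper_entourage S \<epsilon> `` {A}"
proof -
  \<comment> \<open>On this part d(x, A) can be lowered by \<epsilon>/2 and remain a positive
    radius.\<close>
  define S' where "S' = {x \<in> S. \<epsilon> \<le> infdist x A}"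
  \<comment> \<open>Off \<open>S'\<close> the entourage condition holds for every \<open>C\<close>.\<close>
  have *: "gap_nbhd F \<subseteq> upper_entourage S \<epsilon> `` {A}"
    if "\<And>C x. C \<in> gap_nbhd F \<Longrightarrow> x \<in> S' \<Longrightarrow> infdist x A - infdist x C < \<epsilon>" for F
  proof
    fix C assume C: "C \<in> gap_nbhd F"
    have "infdist x A - infdist x C < \<epsilon>" if "x \<in> S" for x
    proof (cases "x \<in> S'")
      case False
      then show ?thesis using that infdist_nonneg[of x C] by (simp add: S'_def)
    qed (use \<open>\<And>C x. C \<in> gap_nbhd F \<Longrightarrow> x \<in> S' \<Longrightarrow> infdist x A - infdist x C < \<epsilon>\<close> C in blast)
    then show "C \<in> upper_entourage S \<epsilon> `` {A}"
      using A C by (auto simp: upper_entourage_def gap_nbhd_def)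
  qed
  show thesis
  proof (cases "S' = {}")
    case True
    show thesis by (rule that[of "{}"]) (use A True * in \<open>auto simp: gap_nbhd_def\<close>)
  next
    case False
    have "S' \<subseteq> S" by (auto simp: S'_def)
    then have S': "S' \<in> \<S>" using \<S> S False by (simp add: bornology_def)
    \<comment> \<open>The maximum makes \<open>g\<close> positive on all of the space without
      changing d(x, A) on \<open>S'\<close>. Subtracting \<epsilon>/2 gives a uniform margin, keeps
      \<open>f\<close> positive and stays strictly within the allowed loss \<epsilon>.\<close>
    define g where "g = (\<lambda>x. max \<epsilon> (infdist x A))"
    define f where "f = (\<lambda>x. g x - \<epsilon> / 2)"
    have g: "g \<in> positive_functions" and f: "f \<in> positive_functions"
      using \<open>\<epsilon> > 0\<close> by (auto simp: positive_functions_def f_def g_def less_max_iff_disj)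
    have g_eq: "g x = infdist x A" if "x \<in> S'" for x
      using that by (simp add: g_def S'_def)
    have "ereal (\<epsilon> / 2) \<le> (INF x\<in>S'. ereal (g x - f x))"
      by (rule INF_greatest) (simp add: f_def)
    then have inf: "(INF x\<in>S'. ereal (g x - f x)) > 0"
      using \<open>\<epsilon> > 0\<close> by (auto intro: less_le_trans[rotated])
    have gA: "fun_enlargement S' g \<inter> A = {}"
      by (simp add: fun_enlargement_disjoint_iff g_eq infdist_le)
    \<comment> \<open>The nonempty \<open>A\<close> lies outside, which rules out the second
      alternative of the hypothesis.\<close>
    then have "fun_enlargement S' g \<noteq> UNIV" using A by (auto simp: nonempty_sets_def)
    then have "strictly_included \<S> (fun_enlargement S' f) (fun_enlargement S' g)"
      using incl S' f g inf by blast
    then obtain n :: nat and T :: "nat \<Rightarrow> 'a set" and \<alpha> \<beta> :: "nat \<Rightarrow> real" where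
      T: "\<And>i. i \<in> {1..n} \<Longrightarrow> T i \<in> \<S> \<and> 0 < \<alpha> i \<and> \<alpha> i < \<beta> i"
      and lower: "fun_enlargement S' f \<subseteq> (\<Union>i\<in>{1..n}. enlargement (T i) (\<alpha> i))"
      and upper: "(\<Union>i\<in>{1..n}. enlargement (T i) (\<beta> i)) \<subseteq> fun_enlargement S' g"
      by (rule strictly_includedE) (rule that)
    define F where "F = (\<lambda>i. (T i, \<alpha> i)) ` {1..n}"
    show thesis
    proof (rule that)
      show "finite F" "fst ` F \<subseteq> \<S>" using T by (auto simp: F_def)
      have "\<alpha> i < setdist (T i) A" if i: "i \<in> {1..n}" for i
      proof -
        have "enlargement (T i) (\<beta> i) \<inter> A = {}" using upper gA i by blast
        then have "\<beta> i \<le> infdist y (T i)" if "y \<in> A" for y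
          using that by (force simp: enlargement_def not_less[symmetric])
        moreover have "T i \<noteq> {}" using T[OF i] \<S> by (auto simp: bornology_def nonempty_sets_def)
        ultimately have "\<alpha> i < setdist A (T i)"
          using T[OF i] A by (intro less_setdist_infdistI[of _ _ "\<beta> i"]) (auto simp: nonempty_sets_def)
        then show ?thesis by (simp add: setdist_sym)
      qed
      then show "A \<in> gap_nbhd F" using A by (auto simp: gap_nbhd_def F_def)
      show "gap_nbhd F \<subseteq> upper_entourage S \<epsilon> `` {A}"
      proof (rule *)
        fix C x assume C: "C \<in> gap_nbhd F" and x: "x \<in> S'"
        have "enlargement (T i) (\<alpha> i) \<inter> C = {}" if i: "i \<in> {1..n}" for i
        proof -
          have "\<alpha> i < setdist C (T i)"
            using C i by (auto simp: gap_nbhd_def F_def setdist_sym)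
          then show ?thesis
            using setdist_le_infdist[of _ C "T i"] by (force simp: enlargement_def)
        qed
        then have "fun_enlargement S' f \<inter> C = {}" using lower by blast
        then have "\<And>c. c \<in> C \<Longrightarrow> f x \<le> dist x c"
          using x by (simp add: fun_enlargement_disjoint_iff)
        \<comment> \<open>\<open>infdist\<close> to the empty set is 0 by convention, so the bound
          on \<open>infdist x C\<close> relies on \<open>C\<close> being nonempty.\<close>
        moreover have "C \<noteq> {}" using C by (simp add: gap_nbhd_def nonempty_sets_def)
        ultimately have "f x \<le> infdist x C"
          by (simp add: infdist_notempty cINF_greatest)
        then show "infdist x A - infdist x C < \<epsilon>"
          using g_eq[OF x] \<open>\<epsilon> > 0\<close> by (simp add: f_def)
      qed
    qed
  qed
qed

lemma gap_eq_tau_if_strictly_included: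
  fixes \<S> :: "'a::metric_space set set"
  assumes \<S>: "bornology \<S>"
    and incl: "\<forall>S\<in>\<S>. \<forall>f\<in>positive_functions. \<forall>g\<in>positive_functions.
        (INF x\<in>S. ereal (g x - f x)) > 0 \<longrightarrow>
          strictly_included \<S> (fun_enlargement S f) (fun_enlargement S g) \<or>
          fun_enlargement S g = UNIV"
  shows "tau_upper \<S> = upper_gap \<S>"
  unfolding topology_eq
proof (intro allI iffI)
  fix G assume G: "openin (tau_upper \<S>) G"
  show "openin (upper_gap \<S>) G"
  proof (subst openin_subopen, intro ballI)
    fix A assume "A \<in> G"
    then obtain S \<epsilon> where S: "S \<in> \<S>" "\<epsilon> > 0" "upper_entourage S \<epsilon> `` {A} \<subseteq> G"
      and A: "A \<in> nonempty_sets"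
      using G unfolding openin_tau_upper[OF \<S>] by blast
    obtain F where "finite F" "fst ` F \<subseteq> \<S>" "A \<in> gap_nbhd F"
      "gap_nbhd F \<subseteq> upper_entourage S \<epsilon> `` {A}"
      by (rule gap_nbhd_within_entourage[OF \<S> incl S(1,2) A])
    then show "\<exists>H. openin (upper_gap \<S>) H \<and> A \<in> H \<and> H \<subseteq> G"
      using openin_gap_nbhd[OF \<S>] S(3) by (meson order_trans)
  qed
qed (rule upper_gap_coarser_tau_upper[OF \<S>])

theorem theorem5p5:
  fixes \<S> :: "'a::metric_space set set"
  assumes "bornology \<S>"
  shows "subtopology (tau_upper \<S>) nonempty_closed_sets = subtopology (upper_gap \<S>) nonempty_closed_sets
     \<longleftrightarrow>
     (\<forall>S\<in>\<S>. \<forall>f\<in>positive_functions. \<forall>g\<in>positive_functions.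
        (INF x\<in>S. ereal (g x - f x)) > 0 \<longrightarrow>
          strictly_included \<S> (fun_enlargement S f) (fun_enlargement S g) \<or>
          fun_enlargement S g = UNIV)"
    (is "?eq \<longleftrightarrow> ?incl")
proof
  assume ?eq
  then show ?incl using strictly_included_if_gap_eq_tau[OF assms] by blast
next
  assume ?incl
  \<comment> \<open>The equality obtained holds on all nonempty sets and is then restricted to the
    closed ones.\<close>
  then have "tau_upper \<S> = upper_gap \<S>" by (rule gap_eq_tau_if_strictly_included[OF assms])
  then show ?eq by simp
qed

end
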